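(* Let $G$ be an abelian group, $H$ a subgroup of finite index $q=[G:H]$, and $\pi:G\to G/H$ the quotient homomorphism. Let $A\subseteq G$ be a finite set, and for each $k\in G/H$ let $n_k=|\pi^{-1}(k)\cap A|$. If $|A|>256\sqrt{q}$ and $$\sum_{k\in G/H}n_k^2<\frac{|A|^3}{10^5q},$$ then $\pi(\Sigma^*(A))$ contains the identity of $G/H$.
   Context: For a finite set $A$ in an abelian group, $\Sigma^*(A)$ is the set of sums $\sum_{a\in A'}a$ over nonempty subsets $A'\subseteq A$. *)

theory Defs
  imports Complex_Main "HOL-Algebra.Coset" "HOL-Algebra.FiniteProduct"
begin

text \<open>Groups are written multiplicatively, so that the subset sums
  \<open>\<Sum>\<^sup>*(A)\<close> of the additive notation become products.\<close>

definition nonempty_subset_sums :: "('a, 'b) monoid_scheme \<Rightarrow> 'a set \<Rightarrow> 'a set" where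
  "nonempty_subset_sums G A = {finprod G (\<lambda>a. a) B | B. B \<subseteq> A \<and> B \<noteq> {}}"

definition quot_map :: "('a, 'b) monoid_scheme \<Rightarrow> 'a set \<Rightarrow> 'a \<Rightarrow> 'a set" where
  "quot_map G H x = H #>\<^bsub>G\<^esub> x"

definition fibre_card :: "('a, 'b) monoid_scheme \<Rightarrow> 'a set \<Rightarrow> 'a set \<Rightarrow> 'a set \<Rightarrow> nat" where
  "fibre_card G H A k = card ({x \<in> carrier G. quot_map G H x = k} \<inter> A)"

end

theory Submission
  imports Defs "HOL-Algebra.Generated_Groups" "HOL-Analysis.Convex"
begin

text \<open>
  Write \<open>P(T)\<close> for the set of products over all subsets of \<open>T\<close>, the empty one included, and suppose
  that no nonempty subset of \<open>A\<close> has product in \<open>H\<close>. Then \<open>P\<close> is superadditive: the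
  Kemperman--Scherk inequality gives \<open>|P(S \<union> T)| \<ge> |P(S)| + |P(T)| - 1\<close> for disjoint \<open>S\<close> and \<open>T\<close>.

  If \<open>S\<close> maps injectively to the quotient, then \<open>|P(S)| \<ge> |S|\<^sup>2 / 768\<close>. Indeed, if some subgroup
  contains three quarters of \<open>S\<close> but not all of it, one element outside doubles \<open>P\<close>, and induction
  applies. Otherwise small parts of \<open>S\<close> can be deleted without changing the generated subgroup \<open>L\<close>.
  Choose elements greedily and let \<open>B\<close> be the current set of products. The function
  \<open>x \<mapsto> |Bx - B|\<close> is subadditive and symmetric, it is at least \<open>|B| / 2\<close> somewhere on any set of
  size \<open>2|B|\<close>, and balls in the Cayley graph of \<open>L\<close> grow linearly; hence some remaining element
  enlarges \<open>B\<close> by a constant multiple of \<open>|S|\<close>.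

  Finally split \<open>A\<close> into layers, the \<open>j\<close>-th of which contains one element of each fibre with more
  than \<open>j\<close> elements. The second moment hypothesis forces half of \<open>A\<close> into few layers, so by
  Cauchy--Schwarz and superadditivity \<open>P(A)\<close> has more than \<open>q\<close> elements.
\<close>

section \<open>Counting inside the fibres of a map\<close>

lemma sum_lessThan_le_square: "2 * (\<Sum>i<n. i) \<le> n\<^sup>2" for n :: nat
  by (induction n) (auto simp: power2_eq_square)

text \<open>Numbering each fibre 0, 1, 2, ... turns the level sets of \<open>lvl\<close> into the
  layers used later: a level meets every fibre at most once, so \<open>f\<close> is injective on
  it.\<close>

lemma exists_fibre_enumeration:
  fixes f :: "'i \<Rightarrow> 'k"
  assumes "finite A"
  obtains lvl :: "'i \<Rightarrow> nat"
  where "\<And>k. bij_betw lvl {a \<in> A. f a = k} {..<card {a \<in> A. f a = k}}"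
proof -
  have "\<exists>h. bij_betw h {a \<in> A. f a = k} {..<card {a \<in> A. f a = k}}" for k
    using ex_bij_betw_finite_nat[of "{a \<in> A. f a = k}"] assms by (simp add: lessThan_atLeast0)
  then obtain h where h: "\<And>k. bij_betw (h k) {a \<in> A. f a = k} {..<card {a \<in> A. f a = k}}" by metis
  have "bij_betw (\<lambda>a. h (f a) a) {a \<in> A. f a = k} {..<card {a \<in> A. f a = k}}" for k
    using h[of k] by (subst bij_betw_cong[of _ _ "h k"]) auto
  then show ?thesis by (rule that)
qed

context comm_group
begin

section \<open>Product sets and the Kemperman--Scherk inequality\<close>

lemma inj_on_mult_right:
  assumes "x \<in> carrier G" "B \<subseteq> carrier G"
  shows "inj_on (\<lambda>b. b \<otimes> x) B"
  using assms by (intro inj_onI) (meson right_cancel subsetD)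

lemma set_multI: "a \<in> A \<Longrightarrow> b \<in> B \<Longrightarrow> a \<otimes> b \<in> A <#> B"
  by (auto simp: set_mult_def)

text \<open>Induction on |B|. Dyson's transform keeps |A| + |B| and the hypotheses about 1, adds no
  element to \<open>A <#> B\<close>, and makes B smaller, until B = {1}.\<close>

lemma card_set_mult_ge:
  assumes "finite A" "finite B" "A \<subseteq> carrier G" "B \<subseteq> carrier G" "\<one> \<in> A" "\<one> \<in> B"
    and "\<And>a b. \<lbrakk>a \<in> A; b \<in> B; a \<otimes> b = \<one>\<rbrakk> \<Longrightarrow> a = \<one> \<and> b = \<one>"
  shows "card A + card B \<le> card (A <#> B) + 1"
  using assms
proof (induction "card B" arbitrary: A B rule: less_induct)
  case less
  note fin = less.prems(1,2) and AB = less.prems(3,4) and one = less.prems(5,6)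
    and triv = less.prems(7)
  have finAB: "finite (A <#> B)" using fin by (simp add: set_mult_def)
  show ?case
  proof (cases "B = {\<one>}")
    case True
    have "a \<otimes> \<one> = a" if "a \<in> A" for a using that AB by auto
    then have "A <#> {\<one>} = A" by (simp add: set_mult_def)
    then show ?thesis unfolding True by simp
  next
    case False
    then obtain b where b: "b \<in> B" "b \<noteq> \<one>" using one by blast
    have bc: "b \<in> carrier G" using b AB by blast
    \<comment> \<open>Transforming with respect to such an \<open>a\<close> removes \<open>b\<close>
      from the second set, so the induction advances. If there were none, finiteness would give A b
      = A, and 1 in A b would be a forbidden representation of 1.\<close>
    have "\<exists>a\<in>A. a \<otimes> b \<notin> A"
    proof (rule ccontr)
      assume "\<not> (\<exists>a\<in>A. a \<otimes> b \<notin> A)"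
      then have "(\<lambda>a. a \<otimes> b) ` A \<subseteq> A" by blast
      with inj_on_mult_right[OF bc AB(1)] fin(1) have "(\<lambda>a. a \<otimes> b) ` A = A"
        by (simp add: endo_inj_surj)
      then have "\<one> \<in> (\<lambda>a. a \<otimes> b) ` A" using one by simp
      then obtain a where "a \<in> A" "a \<otimes> b = \<one>" by auto
      with triv b show False by blast
    qed
    then obtain a where a: "a \<in> A" "a \<otimes> b \<notin> A" by blast
    have ac: "a \<in> carrier G" using a AB by blast
    \<comment> \<open>Dyson's e-transform with respect to \<open>a\<close>.\<close>
    define A' where "A' = A \<union> (\<lambda>y. y \<otimes> a) ` B"
    define B' where "B' = {y \<in> B. y \<otimes> a \<in> A}"
    have finA': "finite A'" and finB': "finite B'"
      using fin by (auto simp: A'_def B'_def)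
    have A'c: "A' \<subseteq> carrier G" and B'c: "B' \<subseteq> carrier G"
      using AB ac by (auto simp: A'_def B'_def)
    have "b \<notin> B'" using a m_comm[OF ac bc] by (simp add: B'_def)
    with b have "B' \<subset> B" by (auto simp: B'_def)
    then have lt: "card B' < card B" using fin by (simp add: psubset_card_mono)
    have "A' <#> B' \<subseteq> A <#> B"
    proof
      fix z assume "z \<in> A' <#> B'"
      then obtain x y where xy: "x \<in> A'" "y \<in> B'" "z = x \<otimes> y" by (auto simp: set_mult_def)
      show "z \<in> A <#> B"
      proof (cases "x \<in> A")
        case True
        with xy show ?thesis by (auto simp: set_mult_def B'_def)
      next
        case False
        with xy obtain w where w: "w \<in> B" "x = w \<otimes> a" by (auto simp: A'_def)
        have "w \<in> carrier G" "y \<in> carrier G" using w xy AB by (auto simp: B'_def)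
        then have "z = (y \<otimes> a) \<otimes> w" using xy w ac by (simp add: m_ac)
        moreover have "y \<otimes> a \<in> A" using xy by (simp add: B'_def)
        ultimately show ?thesis using w set_multI by simp
      qed
    qed
    then have card_le: "card (A' <#> B') \<le> card (A <#> B)" by (rule card_mono[OF finAB])
    have triv': "x = \<one> \<and> y = \<one>" if xy: "x \<in> A'" "y \<in> B'" "x \<otimes> y = \<one>" for x y
    proof (cases "x \<in> A")
      case True
      moreover have "y \<in> B" using xy by (simp add: B'_def)
      ultimately show ?thesis using triv xy(3) by blast
    next
      case False
      with xy obtain w where w: "w \<in> B" "x = w \<otimes> a" by (auto simp: A'_def)
      have c: "w \<in> carrier G" "y \<in> carrier G" using w xy AB by (auto simp: B'_def)
      then have "(y \<otimes> a) \<otimes> w = \<one>" using xy w ac by (simp add: m_ac)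
      then have ya: "y \<otimes> a = \<one>" "w = \<one>" using triv[of "y \<otimes> a" w] w xy by (auto simp: B'_def)
      then have "a \<otimes> y = \<one>" using c ac by (simp add: m_comm)
      then have "a = \<one>" "y = \<one>" using triv[of a y] a xy by (auto simp: B'_def)
      with w ya show ?thesis by simp
    qed
    have "\<one> \<in> A'" "\<one> \<in> B'" using one a ac by (auto simp: A'_def B'_def)
    then have IH: "card A' + card B' \<le> card (A' <#> B') + 1"
      by (rule less.hyps[OF lt finA' finB' A'c B'c _ _ triv'])
    \<comment> \<open>Translation by \<open>a\<close> matches B' with the overlap of A and B a,
      whose union is A'; inclusion-exclusion then preserves the sum of the sizes.\<close>
    have "(\<lambda>y. y \<otimes> a) ` B' = A \<inter> (\<lambda>y. y \<otimes> a) ` B" by (auto simp: B'_def)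
    then have "card B' = card (A \<inter> (\<lambda>y. y \<otimes> a) ` B)"
      using card_image[OF inj_on_mult_right[OF ac B'c]] by simp
    moreover have "card B = card ((\<lambda>y. y \<otimes> a) ` B)"
      using card_image[OF inj_on_mult_right[OF ac AB(2)]] by simp
    ultimately have "card A' + card B' = card A + card B"
      using card_Un_Int[of A "(\<lambda>y. y \<otimes> a) ` B"] fin by (simp add: A'_def)
    with IH card_le show ?thesis by linarith
  qed
qed

subsection \<open>Translates of a finite set\<close>

text \<open>If B is the set of products over T, this is the number of new products gained by
  adjoining to T an index with value \<open>x\<close>. The lemmas below show that it behaves like a
  length function: zero at 1, symmetric and subadditive.\<close>

definition shift_excess :: "'a set \<Rightarrow> 'a \<Rightarrow> nat" where
  "shift_excess B x = card ((\<lambda>b. b \<otimes> x) ` B - B)"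

lemma card_union_shift:
  assumes "finite B"
  shows "card (B \<union> (\<lambda>b. b \<otimes> x) ` B) = card B + shift_excess B x"
proof -
  have "B \<union> (\<lambda>b. b \<otimes> x) ` B = B \<union> ((\<lambda>b. b \<otimes> x) ` B - B)" by blast
  then show ?thesis
    unfolding shift_excess_def using assms by (metis Diff_disjoint card_Un_disjoint finite_Diff finite_imageI)
qed

lemma shift_excess_one:
  assumes "B \<subseteq> carrier G"
  shows "shift_excess B \<one> = 0"
proof -
  have "(\<lambda>b. b \<otimes> \<one>) ` B = B" using assms by (force simp: subset_iff)
  then show ?thesis by (simp add: shift_excess_def)
qed

lemma shift_excess_plus_card_stay:
  assumes "finite B" "B \<subseteq> carrier G" "x \<in> carrier G"
  shows "shift_excess B x + card {b \<in> B. b \<otimes> x \<in> B} = card B"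
proof -
  let ?s = "\<lambda>b. b \<otimes> x"
  have "?s ` {b \<in> B. b \<otimes> x \<in> B} = ?s ` B \<inter> B" by blast
  moreover have "inj_on ?s {b \<in> B. b \<otimes> x \<in> B}" using assms by (intro inj_on_mult_right) auto
  ultimately have "card {b \<in> B. b \<otimes> x \<in> B} = card (?s ` B \<inter> B)"
    using card_image by fastforce
  moreover have "card (?s ` B) = card B"
    using card_image[OF inj_on_mult_right[OF assms(3,2)]] .
  moreover have "card (?s ` B) = card (?s ` B - B) + card (?s ` B \<inter> B)"
    using assms(1) by (metis card_Diff_subset_Int card_mono diff_add finite_Int finite_imageI inf_le1)
  ultimately show ?thesis by (simp add: shift_excess_def)
qed

text \<open>Translation by \<open>x\<close> carries the elements of B that stay in B under
  \<open>x\<close> bijectively onto those that stay under its inverse.\<close>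

lemma shift_excess_inv:
  assumes "finite B" "B \<subseteq> carrier G" "x \<in> carrier G"
  shows "shift_excess B (inv x) = shift_excess B x"
proof -
  have "(\<lambda>b. b \<otimes> x) ` {b \<in> B. b \<otimes> x \<in> B} = {b \<in> B. b \<otimes> inv x \<in> B}"
  proof (intro equalityI subsetI)
    fix y assume "y \<in> {b \<in> B. b \<otimes> inv x \<in> B}"
    then have "y \<in> carrier G" "y \<in> B" "y \<otimes> inv x \<in> B" using assms by auto
    moreover from this assms have "y \<otimes> inv x \<otimes> x = y" by (simp add: m_assoc)
    ultimately show "y \<in> (\<lambda>b. b \<otimes> x) ` {b \<in> B. b \<otimes> x \<in> B}" by force
  next
    fix y assume "y \<in> (\<lambda>b. b \<otimes> x) ` {b \<in> B. b \<otimes> x \<in> B}"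
    then obtain b where b: "b \<in> B" "b \<otimes> x \<in> B" "y = b \<otimes> x" by blast
    then have "y \<otimes> inv x = b" using assms by (auto simp: m_assoc)
    with b show "y \<in> {b \<in> B. b \<otimes> inv x \<in> B}" by simp
  qed
  moreover have "inj_on (\<lambda>b. b \<otimes> x) {b \<in> B. b \<otimes> x \<in> B}"
    using assms by (intro inj_on_mult_right) auto
  ultimately have "card {b \<in> B. b \<otimes> inv x \<in> B} = card {b \<in> B. b \<otimes> x \<in> B}"
    using card_image by fastforce
  then show ?thesis
    using shift_excess_plus_card_stay[OF assms]
      shift_excess_plus_card_stay[OF assms(1,2) inv_closed[OF assms(3)]] by linarith
qed

text \<open>If b x y leaves B, then either b x has already left B, or b x lies in B and leaves it
  under y.\<close>

lemma shift_excess_mult_le: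
  assumes "finite B" "B \<subseteq> carrier G" "x \<in> carrier G" "y \<in> carrier G"
  shows "shift_excess B (x \<otimes> y) \<le> shift_excess B x + shift_excess B y"
proof -
  let ?X = "(\<lambda>b. b \<otimes> x) ` B - B" and ?Y = "(\<lambda>b. b \<otimes> y) ` B - B"
  have "(\<lambda>b. b \<otimes> (x \<otimes> y)) ` B - B \<subseteq> (\<lambda>b. b \<otimes> y) ` ?X \<union> ?Y"
  proof
    fix z assume "z \<in> (\<lambda>b. b \<otimes> (x \<otimes> y)) ` B - B"
    then obtain b where b: "b \<in> B" "z = b \<otimes> (x \<otimes> y)" "z \<notin> B" by blast
    then have "z = (b \<otimes> x) \<otimes> y" using assms by (auto simp: m_assoc)
    with b show "z \<in> (\<lambda>b. b \<otimes> y) ` ?X \<union> ?Y" by blast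
  qed
  then have "card ((\<lambda>b. b \<otimes> (x \<otimes> y)) ` B - B) \<le> card ((\<lambda>b. b \<otimes> y) ` ?X \<union> ?Y)"
    using assms(1) by (intro card_mono) auto
  also have "\<dots> \<le> card ((\<lambda>b. b \<otimes> y) ` ?X) + card ?Y" by (rule card_Un_le)
  also have "\<dots> \<le> card ?X + card ?Y" using assms(1) by (simp add: card_image_le)
  finally show ?thesis by (simp add: shift_excess_def)
qed

text \<open>Double counting of the pairs (y, b) with b and b y in B. They inject into B x B, so
  there are at most |B|^2 of them; if every y kept more than half of B, there would be more than |Y|
  |B| / 2.\<close>

lemma exists_large_shift_excess:
  assumes "finite B" "B \<subseteq> carrier G" "finite Y" "Y \<subseteq> carrier G" "Y \<noteq> {}" "2 * card B \<le> card Y"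
  shows "\<exists>y\<in>Y. card B \<le> 2 * shift_excess B y"
proof (rule ccontr)
  assume neg: "\<not> ?thesis"
  define P where "P = (SIGMA y:Y. {b \<in> B. b \<otimes> y \<in> B})"
  have stay: "card B < 2 * card {b \<in> B. b \<otimes> y \<in> B}" if "y \<in> Y" for y
    using neg that shift_excess_plus_card_stay[OF assms(1,2), of y] assms(4) by force
  have "inj_on (\<lambda>(y, b). (b, b \<otimes> y)) P"
  proof (rule inj_onI, clarsimp simp: P_def)
    fix y y' b assume "y \<in> Y" "y' \<in> Y" "b \<in> B" "b \<otimes> y = b \<otimes> y'"
    with assms show "y = y'" by (metis subsetD Units_eq Units_l_cancel)
  qed
  moreover have "(\<lambda>(y, b). (b, b \<otimes> y)) ` P \<subseteq> B \<times> B" by (auto simp: P_def)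
  ultimately have "card P \<le> card B * card B"
    using assms(1) by (metis card_cartesian_product card_inj_on_le finite_cartesian_product)
  moreover have "card P = (\<Sum>y\<in>Y. card {b \<in> B. b \<otimes> y \<in> B})"
    unfolding P_def using assms by (intro card_SigmaI) auto
  moreover have "card Y * card B < 2 * (\<Sum>y\<in>Y. card {b \<in> B. b \<otimes> y \<in> B})"
    unfolding sum_distrib_left
    using sum_strict_mono[of Y "\<lambda>_. card B" "\<lambda>y. 2 * card {b \<in> B. b \<otimes> y \<in> B}"] stay assms(3,5) by simp
  moreover have "2 * card B * card B \<le> card Y * card B" using assms(6) by simp
  ultimately show False by linarith
qed

subsection \<open>Growth of balls\<close>

text \<open>For symmetric X containing 1 this is the ball of radius n about 1 in the Cayley
  graph.\<close>

primrec set_power :: "'a set \<Rightarrow> nat \<Rightarrow> 'a set" where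
  "set_power X 0 = {\<one>}"
| "set_power X (Suc n) = set_power X n <#> X"

lemma set_power_closed:
  assumes "X \<subseteq> carrier G"
  shows "set_power X n \<subseteq> carrier G"
proof (induction n)
  case (Suc n)
  then show ?case using set_mult_closed[OF Suc assms] by simp
qed simp

lemma set_power_mono_Suc:
  assumes "X \<subseteq> carrier G" "\<one> \<in> X"
  shows "set_power X n \<subseteq> set_power X (Suc n)"
proof
  fix z assume z: "z \<in> set_power X n"
  then have "z \<otimes> \<one> = z" using set_power_closed[OF assms(1)] by (meson r_one subsetD)
  with set_multI[OF z assms(2)] show "z \<in> set_power X (Suc n)" by simp
qed

lemma one_in_set_power:
  assumes "X \<subseteq> carrier G" "\<one> \<in> X"
  shows "\<one> \<in> set_power X n"
proof (induction n)
  case (Suc n)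
  then show ?case using set_power_mono_Suc[OF assms, of n] by blast
qed simp

lemma set_power_inv:
  assumes "X \<subseteq> carrier G" "\<And>x. x \<in> X \<Longrightarrow> inv x \<in> X" "z \<in> set_power X n"
  shows "inv z \<in> set_power X n"
  using assms(3)
proof (induction n arbitrary: z)
  case (Suc n)
  then obtain y x where yx: "y \<in> set_power X n" "x \<in> X" "z = y \<otimes> x" by (auto simp: set_mult_def)
  then have "inv z = inv y \<otimes> inv x"
    using assms(1) set_power_closed[OF assms(1), of n] by (metis inv_mult subsetD)
  with yx Suc.IH assms(2) show ?case by (auto simp: set_mult_def)
qed auto

lemma set_power_stable_subgroup:
  assumes "X \<subseteq> carrier G" "\<one> \<in> X" "\<And>x. x \<in> X \<Longrightarrow> inv x \<in> X"
    and "set_power X (Suc n) = set_power X n"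
  shows "subgroup (set_power X n) G" "X \<subseteq> set_power X n"
proof -
  \<comment> \<open>Induction on the word length m of the second factor; closure of the stable ball
    under multiplication is the case m = n.\<close>
  have mult: "y \<otimes> z \<in> set_power X n" if "y \<in> set_power X n" "z \<in> set_power X m" for y z m
    using that
  proof (induction m arbitrary: z)
    case 0
    then show ?case using set_power_closed[OF assms(1), of n] by auto
  next
    case (Suc m)
    then obtain w x where wx: "w \<in> set_power X m" "x \<in> X" "z = w \<otimes> x" by (auto simp: set_mult_def)
    have "y \<otimes> z = (y \<otimes> w) \<otimes> x"
      using wx Suc.prems assms(1) set_power_closed[OF assms(1)] by (metis m_assoc subsetD)
    moreover have "(y \<otimes> w) \<otimes> x \<in> set_power X (Suc n)"
      using Suc.IH[OF Suc.prems(1) wx(1)] wx(2) by (auto simp: set_mult_def)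
    ultimately show ?case using assms(4) by simp
  qed
  show "subgroup (set_power X n) G"
    using set_power_closed[OF assms(1), of n] one_in_set_power[OF assms(1,2), of n] mult
      set_power_inv[OF assms(1,3)]
    by (intro subgroupI) blast+
  show "X \<subseteq> set_power X n"
  proof
    fix x assume x: "x \<in> X"
    have "\<one> \<otimes> x \<in> set_power X (Suc n)"
      using one_in_set_power[OF assms(1,2), of n] x by (auto simp: set_mult_def)
    with assms(1,4) x show "x \<in> set_power X n" by auto
  qed
qed

text \<open>Iterated, this makes the balls grow linearly, by |X| for every three units of radius,
  for as long as they keep growing.\<close>

lemma card_set_power_add3:
  assumes "finite (carrier G)" "X \<subseteq> carrier G" "\<one> \<in> X" "\<And>x. x \<in> X \<Longrightarrow> inv x \<in> X"
    and "set_power X (Suc (Suc n)) \<noteq> set_power X (Suc n)"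
  shows "card (set_power X n) + card X \<le> card (set_power X (Suc (Suc (Suc n))))"
proof -
  note cl = set_power_closed[OF assms(2)] and mono = set_power_mono_Suc[OF assms(2,3)]
  obtain y where y: "y \<in> set_power X (Suc (Suc n))" "y \<notin> set_power X (Suc n)"
    using assms(5) mono by blast
  have yc: "y \<in> carrier G" using y cl by blast
  let ?Y = "(\<lambda>x. x \<otimes> y) ` X"
  \<comment> \<open>\<open>y\<close> has word length \<open>n + 2\<close>, so the ball of radius 1 about it misses the ball of radius \<open>n\<close>.\<close>
  have disj: "set_power X n \<inter> ?Y = {}"
  proof (rule ccontr)
    assume "set_power X n \<inter> ?Y \<noteq> {}"
    then obtain x where x: "x \<in> X" "x \<otimes> y \<in> set_power X n" by auto
    have xc: "x \<in> carrier G" using x assms(2) by blast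
    have "(x \<otimes> y) \<otimes> inv x \<in> set_power X (Suc n)"
      using x assms(4) by (auto simp: set_mult_def)
    moreover have "(x \<otimes> y) \<otimes> inv x = y" using xc yc
      by (metis inv_closed inv_solve_right m_closed m_comm)
    ultimately show False using y by simp
  qed
  have "x \<otimes> y \<in> set_power X (Suc (Suc (Suc n)))" if "x \<in> X" for x
  proof -
    have "x \<otimes> y = y \<otimes> x" using that assms(2) yc by (auto intro: m_comm)
    then show ?thesis using that y(1) unfolding set_power.simps(2)[of X "Suc (Suc n)"] by (auto simp: set_mult_def)
  qed
  moreover have "set_power X n \<subseteq> set_power X (Suc (Suc (Suc n)))" using mono by (meson subset_trans)
  ultimately have "set_power X n \<union> ?Y \<subseteq> set_power X (Suc (Suc (Suc n)))" by blast
  then have "card (set_power X n \<union> ?Y) \<le> card (set_power X (Suc (Suc (Suc n))))"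
    by (rule card_mono[OF finite_subset[OF cl assms(1)]])
  moreover have "card (set_power X n \<union> ?Y) = card (set_power X n) + card ?Y"
    using disj finite_subset[OF cl assms(1)] finite_subset[OF assms(2,1)]
    by (intro card_Un_disjoint) auto
  moreover have "card ?Y = card X" using card_image[OF inj_on_mult_right[OF yc assms(2)]] .
  ultimately show ?thesis by linarith
qed

lemma shift_excess_set_power_le:
  assumes "finite B" "B \<subseteq> carrier G" "X \<subseteq> carrier G" "\<And>x. x \<in> X \<Longrightarrow> shift_excess B x \<le> t"
    and "y \<in> set_power X n"
  shows "shift_excess B y \<le> n * t"
  using assms(5)
proof (induction n arbitrary: y)
  case 0
  then show ?case using shift_excess_one[OF assms(2)] by simp
next
  case (Suc n)
  then obtain w x where wx: "w \<in> set_power X n" "x \<in> X" "y = w \<otimes> x" by (auto simp: set_mult_def)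
  then have "shift_excess B y \<le> shift_excess B w + shift_excess B x"
    using shift_excess_mult_le[OF assms(1,2)] set_power_closed[OF assms(3)] assms(3) by blast
  also have "\<dots> \<le> n * t + t" using Suc.IH wx assms(4) by (intro add_mono) auto
  finally show ?case by simp
qed

text \<open>Let h be the least radius whose ball has at least 2|B| elements. Some element of that
  ball has excess at least |B| / 2 and is a product of h generators, so by subadditivity one
  generator has excess at least |B| / (2h). Linear growth gives h <= 1 + 6|B| / |X|; the conclusion
  is this bound with denominators cleared.\<close>

lemma exists_large_shift_excess_generator:
  assumes fin: "finite (carrier G)" and B: "B \<subseteq> carrier G" "B \<noteq> {}"
    and X: "X \<subseteq> carrier G" "\<one> \<in> X" "\<And>x. x \<in> X \<Longrightarrow> inv x \<in> X"
    and big: "\<And>M. \<lbrakk>subgroup M G; X \<subseteq> M\<rbrakk> \<Longrightarrow> 2 * card B \<le> card M"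
  shows "\<exists>x\<in>X. card B * card X \<le> shift_excess B x * (2 * card X + 12 * card B)"
proof -
  note cl = set_power_closed[OF X(1)] and mono = set_power_mono_Suc[OF X(1,2)]
  have finB: "finite B" and finX: "finite X" and finP: "\<And>n. finite (set_power X n)"
    using finite_subset[OF _ fin] B(1) X(1) cl by blast+
  let ?Q = "\<lambda>n. 2 * card B \<le> card (set_power X n)"
  \<comment> \<open>A ball that stops growing is a subgroup containing X, and \<open>big\<close>
    then makes it large enough.\<close>
  have grow: "set_power X (Suc n) \<noteq> set_power X n" if "\<not> ?Q n" for n
    using set_power_stable_subgroup[OF X, of n] big that by blast
  have "\<exists>n. ?Q n"
  proof (rule ccontr)
    assume neg: "\<nexists>n. ?Q n"
    have "n < card (set_power X n)" for n
    proof (induction n)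
      case (Suc n)
      have "set_power X n \<subset> set_power X (Suc n)" using mono grow neg by blast
      then have "card (set_power X n) < card (set_power X (Suc n))"
        by (rule psubset_card_mono[OF finP])
      with Suc show ?case by linarith
    qed simp
    with neg show False by (meson less_imp_le)
  qed
  then obtain h where h: "?Q h" and hmin: "\<And>n. n < h \<Longrightarrow> \<not> ?Q n"
    using exists_least_iff[of ?Q] by blast
  have "card B > 0" using finB B by (simp add: card_gt_0_iff)
  then have "h \<noteq> 0" using h by (cases h) auto
  then obtain g where g: "h = Suc g" by (cases h) auto
  \<comment> \<open>\<open>card_set_power_add3\<close> raises the radius by three, hence the factor
    3 and the three base cases.\<close>
  have lin: "n * card X \<le> 3 * card (set_power X n)" if "n < h" for n
    using that
  proof (induction n rule: less_induct)
    case (less n)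
    have "X \<subseteq> set_power X (Suc 0)"
    proof
      fix x assume "x \<in> X"
      moreover from this have "\<one> \<otimes> x = x" using X by auto
      ultimately show "x \<in> set_power X (Suc 0)" using set_multI[of \<one> "{\<one>}" x X] by simp
    qed
    then have one: "card X \<le> card (set_power X (Suc 0))" by (rule card_mono[OF finP])
    have two: "card (set_power X (Suc 0)) \<le> card (set_power X (Suc (Suc 0)))"
      by (rule card_mono[OF finP mono])
    consider "n = 0" | "n = Suc 0" | "n = Suc (Suc 0)" | m where "n = Suc (Suc (Suc m))"
      by (metis not0_implies_Suc)
    then show ?case
    proof cases
      case 4
      then have "m * card X \<le> 3 * card (set_power X m)" using less by simp
      moreover have "card (set_power X m) + card X \<le> card (set_power X n)"
        unfolding 4 using 4 less.prems by (intro card_set_power_add3[OF fin X] grow hmin) auto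
      moreover have "n * card X = m * card X + 3 * card X" using 4 by simp
      ultimately show ?thesis by linarith
    next
      case 2
      then show ?thesis using one by simp
    next
      case 3
      then show ?thesis using one two by (simp del: set_power.simps)
    qed simp
  qed
  define t where "t = Max (shift_excess B ` X)"
  have le_t: "shift_excess B x \<le> t" if "x \<in> X" for x
    unfolding t_def using finX that by simp
  have "t \<in> shift_excess B ` X" unfolding t_def using finX X(2) by (intro Max_in) auto
  then obtain x where x: "x \<in> X" "t = shift_excess B x" by blast
  obtain y where y: "y \<in> set_power X h" "card B \<le> 2 * shift_excess B y"
    using exists_large_shift_excess[OF finB B(1) finP cl _ h] one_in_set_power[OF X(1,2)] by blast
  have "shift_excess B y \<le> h * t"
    using shift_excess_set_power_le[OF finB B(1) X(1)] le_t y(1) by blast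
  then have "card B \<le> 2 * (h * t)" using y(2) by linarith
  then have "card B * card X \<le> 2 * (h * t) * card X" by simp
  also have "\<dots> = 2 * t * (card X + g * card X)" by (simp add: g algebra_simps)
  \<comment> \<open>The radius g = h - 1 is below the threshold, so its ball has fewer than 2|B|
    elements and \<open>lin\<close> gives g|X| <= 6|B|.\<close>
  also have "\<dots> \<le> 2 * t * (card X + 6 * card B)"
    using lin[of g] hmin[of g] g by (intro mult_left_mono add_left_mono) auto
  also have "\<dots> = shift_excess B x * (2 * card X + 12 * card B)"
    unfolding x(2) by algebra
  finally show ?thesis using x(1) by blast
qed

subsection \<open>Subset products\<close>

text \<open>Indexed by a map because distinct elements of A may have the same image in the quotient
  and must be counted separately. The empty subset puts 1 among the products, as
  \<open>card_set_mult_ge\<close> requires.\<close>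

definition subset_prods :: "('i \<Rightarrow> 'a) \<Rightarrow> 'i set \<Rightarrow> 'a set" where
  "subset_prods f T = finprod G f ` Pow T"

definition product_one_free :: "('i \<Rightarrow> 'a) \<Rightarrow> 'i set \<Rightarrow> bool" where
  "product_one_free f T \<longleftrightarrow> (\<forall>U\<subseteq>T. U \<noteq> {} \<longrightarrow> finprod G f U \<noteq> \<one>)"

lemma product_one_free_subset: "product_one_free f T \<Longrightarrow> U \<subseteq> T \<Longrightarrow> product_one_free f U"
  by (auto simp: product_one_free_def)

lemma subset_prods_mono: "U \<subseteq> T \<Longrightarrow> subset_prods f U \<subseteq> subset_prods f T"
  by (auto simp: subset_prods_def)

lemma finite_subset_prods: "finite T \<Longrightarrow> finite (subset_prods f T)"
  by (simp add: subset_prods_def)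

lemma one_in_subset_prods: "\<one> \<in> subset_prods f T"
  unfolding subset_prods_def by (rule image_eqI[of _ _ "{}"]) auto

lemma subset_prods_closed:
  assumes "f \<in> T \<rightarrow> carrier G"
  shows "subset_prods f T \<subseteq> carrier G"
  using assms by (auto simp: subset_prods_def intro!: finprod_closed)

lemma subset_prods_Un:
  assumes "finite S" "finite T" "S \<inter> T = {}" "f \<in> S \<union> T \<rightarrow> carrier G"
  shows "subset_prods f (S \<union> T) = subset_prods f S <#> subset_prods f T"
proof -
  have split: "finprod G f (U \<union> V) = finprod G f U \<otimes> finprod G f V" if "U \<subseteq> S" "V \<subseteq> T" for U V
  proof (rule finprod_Un_disjoint)
    show "finite U" "finite V" using that assms finite_subset by auto
    show "U \<inter> V = {}" using that assms by auto
    show "f \<in> U \<rightarrow> carrier G" "f \<in> V \<rightarrow> carrier G" using that assms(4) by auto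
  qed
  show ?thesis
  proof (intro equalityI subsetI)
    fix z assume "z \<in> subset_prods f (S \<union> T)"
    then obtain W where W: "W \<subseteq> S \<union> T" "z = finprod G f W" by (auto simp: subset_prods_def)
    then have "W = (W \<inter> S) \<union> (W \<inter> T)" by blast
    then have "z = finprod G f (W \<inter> S) \<otimes> finprod G f (W \<inter> T)"
      using split[of "W \<inter> S" "W \<inter> T"] W(2) by simp
    then show "z \<in> subset_prods f S <#> subset_prods f T"
      by (auto simp: subset_prods_def intro!: set_multI)
  next
    fix z assume "z \<in> subset_prods f S <#> subset_prods f T"
    then obtain U V where UV: "U \<subseteq> S" "V \<subseteq> T" "z = finprod G f U \<otimes> finprod G f V"
      by (auto simp: subset_prods_def set_mult_def)
    then have "z = finprod G f (U \<union> V)" using split by simp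
    moreover have "U \<union> V \<subseteq> S \<union> T" using UV by blast
    ultimately show "z \<in> subset_prods f (S \<union> T)" by (auto simp: subset_prods_def)
  qed
qed

lemma subset_prods_singleton:
  assumes "f x \<in> carrier G"
  shows "subset_prods f {x} = {\<one>, f x}"
  using assms by (simp add: subset_prods_def Pow_insert insert_commute)

lemma subset_prods_insert:
  assumes "finite T" "x \<notin> T" "f \<in> insert x T \<rightarrow> carrier G"
  shows "subset_prods f (insert x T) = subset_prods f T \<union> (\<lambda>b. b \<otimes> f x) ` subset_prods f T"
proof -
  have "f x \<in> carrier G" "f \<in> T \<rightarrow> carrier G" using assms(3) by auto
  note cl = subset_prods_closed[OF this(2)] and sing = subset_prods_singleton[of f x, OF this(1)]
  have "subset_prods f (insert x T) = subset_prods f T <#> {\<one>, f x}"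
    using subset_prods_Un[of T "{x}" f] assms sing by simp
  also have "\<dots> = (\<lambda>b. b \<otimes> \<one>) ` subset_prods f T \<union> (\<lambda>b. b \<otimes> f x) ` subset_prods f T"
    by (auto simp: set_mult_def)
  also have "(\<lambda>b. b \<otimes> \<one>) ` subset_prods f T = subset_prods f T"
    using cl by (force simp: subset_iff)
  finally show ?thesis .
qed

lemma subset_prods_subset_subgroup:
  assumes "subgroup M G" "finite T" "f ` T \<subseteq> M"
  shows "subset_prods f T \<subseteq> M"
  using assms(2,3)
proof (induction T rule: finite_induct)
  case empty
  then show ?case using subgroup.one_closed[OF assms(1)] by (simp add: subset_prods_def)
next
  case (insert x T)
  have "f \<in> insert x T \<rightarrow> carrier G" using insert.prems subgroup.subset[OF assms(1)] by auto
  moreover have "(\<lambda>b. b \<otimes> f x) ` subset_prods f T \<subseteq> M"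
    using insert subgroup.m_closed[OF assms(1)] by auto
  ultimately show ?case using insert by (simp add: subset_prods_insert)
qed

text \<open>If the products over U and V multiply to 1, then U together with V has product 1 and is
  therefore empty. So 1 has only the trivial representation and \<open>card_set_mult_ge\<close>
  applies.\<close>

lemma card_subset_prods_Un:
  assumes "finite S" "finite T" "S \<inter> T = {}" "f \<in> S \<union> T \<rightarrow> carrier G" "product_one_free f (S \<union> T)"
  shows "card (subset_prods f S) + card (subset_prods f T) \<le> card (subset_prods f (S \<union> T)) + 1"
  unfolding subset_prods_Un[OF assms(1-4)]
proof (rule card_set_mult_ge)
  show "subset_prods f S \<subseteq> carrier G" "subset_prods f T \<subseteq> carrier G"
    using assms(4) by (auto intro!: subset_prods_closed)
  fix a b assume "a \<in> subset_prods f S" "b \<in> subset_prods f T" and ab: "a \<otimes> b = \<one>"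
  then obtain U V where UV: "U \<subseteq> S" "V \<subseteq> T" "a = finprod G f U" "b = finprod G f V"
    by (auto simp: subset_prods_def)
  have "finprod G f (U \<union> V) = finprod G f U \<otimes> finprod G f V"
  proof (rule finprod_Un_disjoint)
    show "finite U" "finite V" using UV assms finite_subset by auto
    show "U \<inter> V = {}" using UV assms by auto
    show "f \<in> U \<rightarrow> carrier G" "f \<in> V \<rightarrow> carrier G" using UV assms(4) by auto
  qed
  then have "finprod G f (U \<union> V) = \<one>" using UV ab by simp
  moreover have "U \<union> V \<subseteq> S \<union> T" using UV by blast
  ultimately have "U \<union> V = {}" using assms(5) unfolding product_one_free_def by blast
  then show "a = \<one> \<and> b = \<one>" using UV by simp
qed (use assms in \<open>simp_all add: finite_subset_prods one_in_subset_prods\<close>)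

lemma card_subset_prods_ge:
  assumes "finite T" "f \<in> T \<rightarrow> carrier G" "product_one_free f T"
  shows "card T + 1 \<le> card (subset_prods f T)"
  using assms
proof (induction T rule: finite_induct)
  case empty
  then show ?case by (simp add: subset_prods_def)
next
  case (insert x T)
  have fx: "f x \<in> carrier G" "f \<in> T \<rightarrow> carrier G" using insert.prems by auto
  have "finprod G f {x} \<noteq> \<one>" using insert.prems(2) unfolding product_one_free_def by blast
  then have "f x \<noteq> \<one>" using fx by simp
  then have "card (subset_prods f {x}) = 2" using fx by (simp add: subset_prods_singleton)
  moreover have "card T + 1 \<le> card (subset_prods f T)"
    using insert.IH fx product_one_free_subset[OF insert.prems(2)] by blast
  ultimately show ?case
    using card_subset_prods_Un[of T "{x}" f] insert by simp
qed

text \<open>The strictness supplies the single unit by which the half-size bound in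
  \<open>card_subset_prods_quadratic\<close> would otherwise fail.\<close>

lemma card_subset_prods_strict_mono:
  assumes "finite T" "f \<in> T \<rightarrow> carrier G" "product_one_free f T" "U \<subset> T"
  shows "card (subset_prods f U) < card (subset_prods f T)"
proof -
  have fin: "finite U" "finite (T - U)" using assms finite_subset by auto
  have un: "U \<union> (T - U) = T" using assms(4) by blast
  have "card (subset_prods f U) + card (subset_prods f (T - U)) \<le> card (subset_prods f T) + 1"
    using card_subset_prods_Un[OF fin, of f] assms(2,3) unfolding un by blast
  moreover have "card (T - U) + 1 \<le> card (subset_prods f (T - U))"
    using fin assms by (intro card_subset_prods_ge) (auto intro: product_one_free_subset)
  moreover have "card (T - U) > 0" using fin assms(4) by (auto simp: card_gt_0_iff)
  ultimately show ?thesis by linarith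
qed

section \<open>Quadratic growth of subset products for injective values\<close>

lemma exists_large_shift_excess_index:
  assumes fin: "finite (carrier G)" and S: "finite S" "S \<noteq> {}" "f \<in> S \<rightarrow> carrier G" "inj_on f S"
    and B: "B \<subseteq> carrier G" "B \<noteq> {}"
    and big: "\<And>M. \<lbrakk>subgroup M G; f ` S \<subseteq> M\<rbrakk> \<Longrightarrow> 2 * card B \<le> card M"
  shows "\<exists>x\<in>S. card B * card S \<le> shift_excess B (f x) * (2 * card S + 12 * card B)"
proof -
  \<comment> \<open>The ball argument needs a symmetric set containing 1. Nothing is lost: 1 has
    excess zero, and an inverse has the same excess as the element itself.\<close>
  define X where "X = f ` S \<union> (\<lambda>x. inv f x) ` S \<union> {\<one>}"
  have finB: "finite B" using B fin finite_subset by blast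
  have fc: "f x \<in> carrier G" if "x \<in> S" for x using S(3) that by auto
  have X: "X \<subseteq> carrier G" "\<one> \<in> X" using fc by (auto simp: X_def)
  have Xinv: "inv x \<in> X" if "x \<in> X" for x
    using that fc by (auto simp: X_def)
  have "2 * card B \<le> card M" if "subgroup M G" "X \<subseteq> M" for M
    using big[of M] that by (auto simp: X_def)
  then obtain z where z: "z \<in> X" "card B * card X \<le> shift_excess B z * (2 * card X + 12 * card B)"
    using exists_large_shift_excess_generator[OF fin B X Xinv] by blast
  have cardS: "card S \<le> card X"
  proof -
    have "card S = card (f ` S)" using S(4) by (simp add: card_image)
    also have "\<dots> \<le> card X" using S(1) by (intro card_mono) (auto simp: X_def)
    finally show ?thesis .
  qed
  have pos: "card B > 0" "card S > 0" using finB B S by (auto simp: card_gt_0_iff)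
  obtain x where x: "x \<in> S" "shift_excess B (f x) = shift_excess B z"
  proof -
    have "z \<noteq> \<one>" using z pos cardS shift_excess_one[OF B(1)] by auto
    then obtain x where "x \<in> S" "z = f x \<or> z = inv f x" using z(1) by (auto simp: X_def)
    then show ?thesis using that shift_excess_inv[OF finB B(1) fc] by metis
  qed
  define t where "t = shift_excess B z"
  have "card B * card X \<le> t * (2 * card X + 12 * card B)" using z by (simp add: t_def)
  \<comment> \<open>The bound b s / (2 s + 12 b) increases with s, so |X| may be replaced by the
    smaller |S|; this is done by cross-multiplication.\<close>
  then have "card B * card X * card S \<le> t * (2 * card X + 12 * card B) * card S" by simp
  also have "\<dots> = t * (2 * card X * card S + 12 * card B * card S)" by algebra
  also have "\<dots> \<le> t * (2 * card X * card S + 12 * card B * card X)"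
    using cardS by (intro mult_left_mono add_left_mono) auto
  also have "\<dots> = t * (2 * card S + 12 * card B) * card X" by algebra
  finally have "(card B * card S) * card X \<le> (t * (2 * card S + 12 * card B)) * card X"
    by (simp add: mult_ac)
  then have "card B * card S \<le> t * (2 * card S + 12 * card B)" using pos cardS by simp
  then show ?thesis using x unfolding t_def by (intro bexI[of _ x]) simp_all
qed

text \<open>Any p indices give at least p + 1 products; each of p further greedy choices gains at
  least p / 3. At most 2p indices are ever used, so 14p leaves at least 12p candidates, and
  \<open>big\<close> ensures that these still generate a large enough subgroup.\<close>

lemma card_subset_prods_robust:
  assumes fin: "finite (carrier G)" and U: "finite U" "f \<in> U \<rightarrow> carrier G" "inj_on f U"
    and free: "product_one_free f U" and card: "14 * p \<le> card U"
    and big: "\<And>T M. \<lbrakk>T \<subseteq> U; card T \<le> 2 * p; subgroup M G; f ` (U - T) \<subseteq> M\<rbrakk>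
                \<Longrightarrow> 2 * card (subset_prods f T) \<le> card M"
  shows "p\<^sup>2 + 3 * p + 3 \<le> 3 * card (subset_prods f U)"
proof -
  have "\<exists>T. T \<subseteq> U \<and> card T = p + i \<and> 3 * (p + 1) + i * p \<le> 3 * card (subset_prods f T)" if "i \<le> p" for i
    using that
  proof (induction i)
    case 0
    obtain T where T: "T \<subseteq> U" "card T = p" using card obtain_subset_with_card_n[of p U] by auto
    have "card T + 1 \<le> card (subset_prods f T)"
      using U T(1) free by (intro card_subset_prods_ge) (auto intro: finite_subset product_one_free_subset)
    with T show ?case by auto
  next
    case (Suc i)
    then obtain T where T: "T \<subseteq> U" "card T = p + i" "3 * (p + 1) + i * p \<le> 3 * card (subset_prods f T)"
      by auto
    define B where "B = subset_prods f T"
    have finT: "finite T" using U T finite_subset by blast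
    have fT: "f \<in> T \<rightarrow> carrier G" using U T by auto
    have cardD: "12 * p \<le> card (U - T)" "card (U - T) > 0"
      using card_Diff_subset[OF finT T(1)] T(2) card Suc.prems by auto
    have "\<exists>x\<in>U - T. card B * card (U - T) \<le> shift_excess B (f x) * (2 * card (U - T) + 12 * card B)"
    proof (rule exists_large_shift_excess_index[OF fin])
      show "finite (U - T)" "U - T \<noteq> {}" using U cardD by (auto simp: card_gt_0_iff)
      show "f \<in> U - T \<rightarrow> carrier G" using U by auto
      show "inj_on f (U - T)" using U(3) by (rule inj_on_subset) auto
      show "B \<subseteq> carrier G" "B \<noteq> {}"
        unfolding B_def using subset_prods_closed[OF fT] one_in_subset_prods by auto
      show "2 * card B \<le> card M" if "subgroup M G" "f ` (U - T) \<subseteq> M" for M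
        unfolding B_def using big[OF T(1) _ that] T(2) Suc.prems by simp
    qed
    then obtain x where x: "x \<in> U - T"
      "card B * card (U - T) \<le> shift_excess B (f x) * (2 * card (U - T) + 12 * card B)" by blast
    define t where "t = shift_excess B (f x)"
    have pB: "p < card B" using T(3) by (simp add: B_def)
    \<comment> \<open>With b > p and s >= 12p one has p (2 s + 12 b) <= 2 b s + s b = 3 b s, so a
      gain below p / 3 contradicts the choice of \<open>x\<close>.\<close>
    have t: "p \<le> 3 * t"
    proof (rule ccontr)
      let ?s = "card (U - T)" and ?b = "card B"
      assume "\<not> p \<le> 3 * t"
      then have "3 * t * (2 * ?s + 12 * ?b) < p * (2 * ?s + 12 * ?b)"
        using pB by (intro mult_strict_right_mono) auto
      moreover have "3 * (?b * ?s) \<le> 3 * t * (2 * ?s + 12 * ?b)" using x(2) by (simp add: t_def)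
      moreover have "p * (2 * ?s + 12 * ?b) = 2 * (p * ?s) + (12 * p) * ?b" by algebra
      moreover have "p * ?s \<le> ?b * ?s" "(12 * p) * ?b \<le> ?s * ?b"
        using pB cardD(1) by (auto intro!: mult_right_mono)
      moreover have "?s * ?b = ?b * ?s" by (rule mult.commute)
      ultimately show False by linarith
    qed
    have "subset_prods f (insert x T) = B \<union> (\<lambda>b. b \<otimes> f x) ` B"
      unfolding B_def using x(1) U T by (intro subset_prods_insert[OF finT]) auto
    then have "card (subset_prods f (insert x T)) = card B + t"
      using card_union_shift[of B "f x"] finite_subset_prods[OF finT] by (simp add: B_def t_def)
    moreover have "card (insert x T) = p + Suc i" "insert x T \<subseteq> U" using x(1) finT T by auto
    ultimately show ?case using T(3) t unfolding B_def by (intro exI[of _ "insert x T"]) auto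
  qed
  from this[of p] obtain T where T: "T \<subseteq> U" "3 * (p + 1) + p * p \<le> 3 * card (subset_prods f T)" by auto
  have "card (subset_prods f T) \<le> card (subset_prods f U)"
    using T(1) U by (intro card_mono finite_subset_prods subset_prods_mono)
  with T(2) show ?thesis by (simp add: power2_eq_square)
qed

text \<open>The constant is 768 = 3 * 16^2: the 3 comes from the gain p / 3 per greedy step, the 16
  from p being |S| / 16 rounded down.\<close>

theorem card_subset_prods_quadratic:
  assumes fin: "finite (carrier G)"
    and "finite S" "f \<in> S \<rightarrow> carrier G" "inj_on f S" "product_one_free f S"
  shows "(card S)\<^sup>2 \<le> 768 * card (subset_prods f S)"
  using assms(2-)
proof (induction "card S" arbitrary: S rule: less_induct)
  case less
  note S = less.prems
  show ?case
  proof (cases "\<exists>M. subgroup M G \<and> \<not> f ` S \<subseteq> M \<and> 3 * card S \<le> 4 * card {s \<in> S. f s \<in> M}")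
    case True
    then obtain M x where M: "subgroup M G" "3 * card S \<le> 4 * card {s \<in> S. f s \<in> M}"
      and x: "x \<in> S" "f x \<notin> M" by blast
    define S' where "S' = {s \<in> S. f s \<in> M}"
    have S': "finite S'" "S' \<subseteq> S" "x \<notin> S'" using S x by (auto simp: S'_def)
    have fS': "f \<in> S' \<rightarrow> carrier G" using S S' by auto
    have "card S' < card S" using S' S x by (intro psubset_card_mono) auto
    then have IH: "(card S')\<^sup>2 \<le> 768 * card (subset_prods f S')"
      using S S' fS' by (intro less.hyps) (auto intro: inj_on_subset product_one_free_subset)
    let ?B = "subset_prods f S'"
    have sub: "?B \<subseteq> M" using M S' by (intro subset_prods_subset_subgroup) (auto simp: S'_def)
    have fx: "f x \<in> carrier G" using S x by auto
    have finB: "finite ?B" using S' by (simp add: finite_subset_prods)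
    \<comment> \<open>Adjoining \<open>x\<close> produces a second coset of \<open>M\<close> and so doubles the number of products.\<close>
    have disj: "?B \<inter> (\<lambda>b. b \<otimes> f x) ` ?B = {}"
    proof (rule ccontr)
      assume "?B \<inter> (\<lambda>b. b \<otimes> f x) ` ?B \<noteq> {}"
      then obtain b where b: "b \<in> ?B" "b \<otimes> f x \<in> ?B" by auto
      then have "b \<in> M" "b \<otimes> f x \<in> M" using sub by auto
      then have "inv b \<otimes> (b \<otimes> f x) \<in> M"
        using M(1) by (simp add: subgroup.m_closed subgroup.m_inv_closed)
      moreover have "inv b \<otimes> (b \<otimes> f x) = f x"
        using fx \<open>b \<in> M\<close> subgroup.mem_carrier[OF M(1)] by (simp add: inv_solve_left')
      ultimately show False using x by simp
    qed
    have "card (?B \<union> (\<lambda>b. b \<otimes> f x) ` ?B) = card ?B + card ((\<lambda>b. b \<otimes> f x) ` ?B)"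
      using disj finB by (intro card_Un_disjoint) auto
    also have "card ((\<lambda>b. b \<otimes> f x) ` ?B) = card ?B"
      using card_image[OF inj_on_mult_right[OF fx subset_prods_closed[OF fS']]] .
    also have "?B \<union> (\<lambda>b. b \<otimes> f x) ` ?B = subset_prods f (insert x S')"
      using S' fS' fx by (intro subset_prods_insert[symmetric]) auto
    finally have "2 * card ?B = card (subset_prods f (insert x S'))" by simp
    also have "\<dots> \<le> card (subset_prods f S)"
      using S S' x by (intro card_mono finite_subset_prods subset_prods_mono) auto
    finally have dbl: "2 * card ?B \<le> card (subset_prods f S)" .
    have "3 * card S \<le> 4 * card S'" using M(2) by (simp add: S'_def)
    \<comment> \<open>Keeping three quarters of S costs a factor 16/9 in the square, less than the
      factor 2 won by doubling.\<close>
    then have "(3 * card S)\<^sup>2 \<le> (4 * card S')\<^sup>2" by (rule power_mono) simp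
    then have "9 * (card S)\<^sup>2 \<le> 16 * (card S')\<^sup>2" by (simp add: power_mult_distrib)
    with IH dbl show ?thesis by linarith
  next
    case False
    \<comment> \<open>With 16p <= |S|, deleting 4p indices leaves three quarters of S, and setting
      aside 2p still leaves the 14p of the greedy lemma.\<close>
    define p where "p = card S div 16"
    have p: "16 * p \<le> card S" "card S < 16 * (p + 1)" by (auto simp: p_def)
    define L where "L = generate G (f ` S)"
    have fS: "f ` S \<subseteq> carrier G" using S by auto
    have L: "subgroup L G" unfolding L_def by (rule generate_is_subgroup[OF fS])
    have PL: "subset_prods f S \<subseteq> L"
      using S L by (intro subset_prods_subset_subgroup) (auto simp: L_def intro: generate.incl)
    have finL: "finite L" using subgroup.subset[OF L] fin finite_subset by blast
    \<comment> \<open>Such an M contains at least three quarters of the values, so by the failure of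
      the first case it contains all of them, hence L.\<close>
    have rob: "card L \<le> card M"
      if M: "subgroup M G" and T: "T \<subseteq> S" "card T \<le> 4 * p" "f ` (S - T) \<subseteq> M" for M T
    proof -
      have finT: "finite T" using T S finite_subset by blast
      have "S - T \<subseteq> {s \<in> S. f s \<in> M}" using T by auto
      then have "card (S - T) \<le> card {s \<in> S. f s \<in> M}" using S by (intro card_mono) auto
      moreover have "card (S - T) = card S - card T" using finT T by (simp add: card_Diff_subset)
      ultimately have "3 * card S \<le> 4 * card {s \<in> S. f s \<in> M}" using T(2) p by linarith
      with False M have "f ` S \<subseteq> M" by blast
      then have "L \<subseteq> M" unfolding L_def by (rule generate_subgroup_incl[OF _ M])
      moreover have "finite M" using subgroup.subset[OF M] fin finite_subset by blast
      ultimately show ?thesis by (rule card_mono[rotated])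
    qed
    have "p\<^sup>2 + 3 * p + 3 \<le> 3 * card (subset_prods f S)"
    proof (cases "p = 0")
      case True
      have "card (subset_prods f S) > 0"
        using S(1) one_in_subset_prods by (auto simp: card_gt_0_iff finite_subset_prods)
      with True show ?thesis by simp
    next
      case False
      then have ppos: "p > 0" by simp
      show ?thesis
      proof (cases "\<exists>T0\<subseteq>S. card T0 \<le> 2 * p \<and> card L < 2 * card (subset_prods f T0)")
        case False
        show ?thesis
        proof (rule card_subset_prods_robust[OF fin S])
          show "14 * p \<le> card S" using p by linarith
          fix T M assume T: "T \<subseteq> S" "card T \<le> 2 * p" and M: "subgroup M G" "f ` (S - T) \<subseteq> M"
          have "card L \<le> card M" using rob[OF M(1) T(1) _ M(2)] T(2) by simp
          moreover have "2 * card (subset_prods f T) \<le> card L" using False T by (meson not_less)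
          ultimately show "2 * card (subset_prods f T) \<le> card M" by linarith
        qed
      next
        case True
        then obtain T0 where T0: "T0 \<subseteq> S" "card T0 \<le> 2 * p" "card L < 2 * card (subset_prods f T0)"
          by blast
        \<comment> \<open>The products over \<open>T0\<close> fill more than half of \<open>L\<close>, which leaves at most half of it to the
           products over the complement of \<open>T0\<close>: the greedy choice is made there instead.\<close>
        define U where "U = S - T0"
        have finT0: "finite T0" using T0 S finite_subset by blast
        have U: "finite U" "f \<in> U \<rightarrow> carrier G" "inj_on f U" "product_one_free f U"
          unfolding U_def using S by (auto intro: inj_on_subset product_one_free_subset)
        have un: "T0 \<union> U = S" using T0 by (auto simp: U_def)
        have cardU: "card U = card S - card T0" unfolding U_def using finT0 T0 by (simp add: card_Diff_subset)
        have "card (subset_prods f T0) + card (subset_prods f U) \<le> card (subset_prods f (T0 \<union> U)) + 1"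
          using S un finT0 U by (intro card_subset_prods_Un) (auto simp: U_def)
        also have "\<dots> \<le> card L + 1" unfolding un using card_mono[OF finL PL] by simp
        finally have half: "2 * card (subset_prods f U) \<le> card L + 1" using T0(3) by linarith
        have "p\<^sup>2 + 3 * p + 3 \<le> 3 * card (subset_prods f U)"
        proof (rule card_subset_prods_robust[OF fin U])
          show "14 * p \<le> card U" using p T0(2) cardU by linarith
          fix T M assume T: "T \<subseteq> U" "card T \<le> 2 * p" and M: "subgroup M G" "f ` (U - T) \<subseteq> M"
          have "card (T0 \<union> T) \<le> 4 * p" using card_Un_le[of T0 T] T(2) T0(2) by linarith
          moreover have "S - (T0 \<union> T) = U - T" by (auto simp: U_def)
          ultimately have "card L \<le> card M"
            using rob[OF M(1), of "T0 \<union> T"] M(2) T(1) T0(1) by (auto simp: U_def)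
          moreover have "2 * card (subset_prods f T) \<le> card L"
          proof -
            \<comment> \<open>\<open>half\<close> exceeds the required bound by one; a proper subset
              of U has at least one product fewer, which makes up for it.\<close>
            have "card T < card U" using T(2) cardU T0(2) p(1) ppos by linarith
            then have "T \<subset> U" using T(1) by auto
            then have "card (subset_prods f T) < card (subset_prods f U)"
              by (rule card_subset_prods_strict_mono[OF U(1,2,4)])
            with half show ?thesis by linarith
          qed
          ultimately show "2 * card (subset_prods f T) \<le> card M" by linarith
        qed
        also have "card (subset_prods f U) \<le> card (subset_prods f S)"
          using S by (intro card_mono finite_subset_prods subset_prods_mono) (auto simp: U_def)
        finally show ?thesis by simp
      qed
    qed
    then have lower: "256 * (p\<^sup>2 + 3 * p + 3) \<le> 768 * card (subset_prods f S)" by simp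
    have "(card S)\<^sup>2 \<le> (16 * (p + 1))\<^sup>2" using p(2) by (intro power_mono) auto
    also have "\<dots> = 256 * (p\<^sup>2 + 2 * p + 1)" by algebra
    also have "\<dots> \<le> 256 * (p\<^sup>2 + 3 * p + 3)" by simp
    finally show ?thesis using lower by (rule order_trans)
  qed
qed

subsection \<open>Layers\<close>

text \<open>The constant is 1536 * 4 * 2: 1536 from the layers, 4 from squaring N <= 2 w, and 2 from
  J N <= 2 Q.\<close>

theorem card_cubed_le_sum_fibre_squares:
  assumes fin: "finite (carrier G)"
    and A: "finite A" "f \<in> A \<rightarrow> carrier G" "product_one_free f A"
  shows "(card A) ^ 3 \<le> 12288 * card (carrier G) * (\<Sum>k\<in>carrier G. (card {a \<in> A. f a = k})\<^sup>2)"
proof (cases "card A = 0")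
  case True
  then show ?thesis by simp
next
  case False
  define N where "N = card A"
  define n where "n k = card {a \<in> A. f a = k}" for k
  define Q where "Q = (\<Sum>k\<in>carrier G. (n k)\<^sup>2)"
  obtain lvl where lvl: "\<And>k. bij_betw lvl {a \<in> A. f a = k} {..<n k}"
    using exists_fibre_enumeration[OF A(1), of f] unfolding n_def by blast
  have fA: "f ` A \<subseteq> carrier G" using A by auto
  have "N = (\<Sum>k\<in>carrier G. n k)"
    using sum.group[OF A(1) fin fA, of "\<lambda>_. 1::nat"] by (simp add: N_def n_def)
  also have "\<dots> \<le> Q" unfolding Q_def by (intro sum_mono) (simp add: power2_eq_square)
  finally have NQ: "N \<le> Q" .
  \<comment> \<open>The levels in a fibre of size n are 0, ..., n - 1, with sum at most n^2 /
    2.\<close>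
  have "2 * (\<Sum>a\<in>A. lvl a) = (\<Sum>k\<in>carrier G. 2 * (\<Sum>a | a \<in> A \<and> f a = k. lvl a))"
    using sum.group[OF A(1) fin fA, of lvl] by (simp flip: sum_distrib_left)
  also have "\<dots> = (\<Sum>k\<in>carrier G. 2 * (\<Sum>i<n k. i))"
    using sum.reindex_bij_betw[OF lvl, of "\<lambda>i. i"] by simp
  also have "\<dots> \<le> Q" unfolding Q_def by (intro sum_mono sum_lessThan_le_square)
  finally have sum_lvl: "2 * (\<Sum>a\<in>A. lvl a) \<le> Q" .
  \<comment> \<open>J is just above Q / N: large enough for the first J layers to hold half of A,
    yet at most 2 Q / N because N <= Q.\<close>
  define J where "J = Q div N + 1"
  have N: "N > 0" using False by (simp add: N_def)
  have J: "Q < J * N" "J * N \<le> 2 * Q"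
  proof -
    show "Q < J * N" using N dividend_less_div_times[of N Q] by (simp add: J_def algebra_simps)
    have "J * N = Q div N * N + N" by (simp add: J_def)
    then show "J * N \<le> 2 * Q" using NQ div_times_less_eq_dividend[of Q N] by linarith
  qed
  define S where "S j = {a \<in> A. lvl a = j}" for j
  define low where "low j = {a \<in> A. lvl a < j}" for j
  have fin_S: "finite (S j)" and fin_low: "finite (low j)" for j
    using A(1) by (auto simp: S_def low_def)
  have inj: "inj_on f (S j)" for j
  proof (rule inj_onI)
    fix a b assume ab: "a \<in> S j" "b \<in> S j" "f a = f b"
    have "inj_on lvl {c \<in> A. f c = f a}" using lvl by (rule bij_betw_imp_inj_on)
    with ab show "a = b" by (auto simp: S_def dest: inj_onD)
  qed
  \<comment> \<open>Superadditivity holds for the number of products minus one. Doubling 768 pays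
    for the subtraction, since a nonempty layer has at least two products.\<close>
  have layer: "(card (S j))\<^sup>2 + 1536 \<le> 1536 * card (subset_prods f (S j))" for j
  proof -
    have fS: "f \<in> S j \<rightarrow> carrier G" "product_one_free f (S j)"
      using A by (auto simp: S_def intro: product_one_free_subset)
    have "card (S j) + 1 \<le> card (subset_prods f (S j))"
      using card_subset_prods_ge[OF fin_S fS] .
    moreover have "(card (S j))\<^sup>2 \<le> 768 * card (subset_prods f (S j))"
      using card_subset_prods_quadratic[OF fin fin_S fS(1) inj fS(2)] .
    ultimately show ?thesis by (cases "card (S j) = 0") auto
  qed
  have layers: "(\<Sum>j<m. (card (S j))\<^sup>2) + 1536 \<le> 1536 * card (subset_prods f (low m))" for m
  proof (induction m)
    case 0
    then show ?case by (simp add: low_def subset_prods_def)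
  next
    case (Suc m)
    have "low (Suc m) = low m \<union> S m" by (auto simp: low_def S_def)
    moreover have "card (subset_prods f (low m)) + card (subset_prods f (S m))
        \<le> card (subset_prods f (low m \<union> S m)) + 1"
      using A fin_low fin_S
      by (intro card_subset_prods_Un) (auto simp: low_def S_def intro: product_one_free_subset)
    ultimately show ?case using Suc layer[of m] by simp
  qed
  have "subset_prods f (low J) \<subseteq> carrier G" using A by (intro subset_prods_closed) (auto simp: low_def)
  then have "card (subset_prods f (low J)) \<le> card (carrier G)" by (rule card_mono[OF fin])
  with layers[of J] have sq: "(\<Sum>j<J. (card (S j))\<^sup>2) \<le> 1536 * card (carrier G)" by linarith
  define w where "w = (\<Sum>j<J. card (S j))"
  have "card (low J) = w"
  proof -
    have "low J = (\<Union>j<J. S j)" by (auto simp: low_def S_def)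
    then show ?thesis
      unfolding w_def using fin_S by (simp add: card_UN_disjoint S_def disjoint_iff)
  qed
  \<comment> \<open>Markov's inequality: elements outside the first J layers have level at least J,
    and the levels sum to at most Q / 2 < J N / 2.\<close>
  have "N \<le> 2 * w"
  proof -
    have sub: "low J \<subseteq> A" by (auto simp: low_def)
    have "J * card (A - low J) = (\<Sum>a\<in>A - low J. J)" by simp
    also have "\<dots> \<le> (\<Sum>a\<in>A - low J. lvl a)" by (intro sum_mono) (auto simp: low_def)
    also have "\<dots> \<le> (\<Sum>a\<in>A. lvl a)" using A(1) by (intro sum_mono2) auto
    finally have "J * (2 * card (A - low J)) < J * N" using sum_lvl J(1) by linarith
    then have "2 * card (A - low J) < N" by simp
    moreover have "card (A - low J) = N - w"
      using card_Diff_subset[OF fin_low sub] \<open>card (low J) = w\<close> by (simp add: N_def)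
    ultimately show ?thesis by linarith
  qed
  have "(\<Sum>j<J. real (card (S j)))\<^sup>2 \<le> (\<Sum>j<J. (real (card (S j)))\<^sup>2) * card {..<J}"
    by (rule sum_squared_le_sum_of_squares)
  then have "real (w\<^sup>2) \<le> real ((\<Sum>j<J. (card (S j))\<^sup>2) * J)" by (simp add: w_def)
  then have "w\<^sup>2 \<le> (\<Sum>j<J. (card (S j))\<^sup>2) * J" unfolding of_nat_le_iff .
  also have "\<dots> \<le> 1536 * card (carrier G) * J" using sq by simp
  finally have w: "w\<^sup>2 \<le> 1536 * card (carrier G) * J" .
  have "N\<^sup>2 \<le> (2 * w)\<^sup>2" using \<open>N \<le> 2 * w\<close> by (rule power_mono) simp
  also have "\<dots> = 4 * w\<^sup>2" by (simp add: power_mult_distrib)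
  also have "\<dots> \<le> 6144 * card (carrier G) * J" using w by linarith
  finally have "N\<^sup>2 * N \<le> 6144 * card (carrier G) * J * N" by simp
  also have "\<dots> = 6144 * card (carrier G) * (J * N)" by simp
  also have "\<dots> \<le> 6144 * card (carrier G) * (2 * Q)" using J(2) by (intro mult_left_mono) auto
  finally show ?thesis by (simp add: N_def Q_def n_def power3_eq_cube power2_eq_square)
qed

section \<open>Passage to the quotient group and the final contradiction\<close>

lemma finprod_quot_map:
  assumes "subgroup H G" "finite U" "U \<subseteq> carrier G"
  shows "finprod (G Mod H) (quot_map G H) U = quot_map G H (finprod G (\<lambda>a. a) U)"
proof -
  interpret H: normal H G using assms(1) by (rule subgroup_imp_normal)
  interpret K: comm_group "G Mod H" using assms(1) by (rule abelian_FactGroup)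
  have hom: "quot_map G H \<in> hom G (G Mod H)"
    using H.r_coset_hom_Mod by (simp add: quot_map_def[abs_def])
  show ?thesis
    using assms(2,3)
  proof (induction U rule: finite_induct)
    case empty
    then show ?case using hom_one[OF hom is_group K.is_group] by simp
  next
    case (insert x U)
    have c: "x \<in> carrier G" "U \<subseteq> carrier G" using insert.prems by auto
    then have "finprod G (\<lambda>a. a) U \<in> carrier G" by (intro finprod_closed) auto
    moreover have "quot_map G H y \<in> carrier (G Mod H)" if "y \<in> carrier G" for y
      using that hom by (rule hom_in_carrier[rotated])
    ultimately show ?case
      using insert c hom_mult[OF hom] by (subst K.finprod_insert) (auto simp: Pi_def subset_iff)
  qed
qed

end

theorem theorem5p3:
  fixes G :: "('a, 'b) monoid_scheme" and H A :: "'a set" and q :: nat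
  assumes "comm_group G"
    and "subgroup H G"
    and "finite (carrier (G Mod H))"
    and "q = card (carrier (G Mod H))"
    and "A \<subseteq> carrier G"
    and "finite A"
    and "real (card A) > 256 * sqrt (real q)"
    and "(\<Sum>k\<in>carrier (G Mod H). (real (fibre_card G H A k))\<^sup>2)
           < real (card A) ^ 3 / (10 ^ 5 * real q)"
  shows "\<one>\<^bsub>G Mod H\<^esub> \<in> quot_map G H ` nonempty_subset_sums G A"
proof (rule ccontr)
  assume neg: "\<not> ?thesis"
  interpret comm_group G by (rule assms(1))
  interpret H: normal H G using assms(2) by (rule subgroup_imp_normal)
  interpret K: comm_group "G Mod H" using assms(2) by (rule abelian_FactGroup)
  have qc: "quot_map G H y \<in> carrier (G Mod H)" if "y \<in> carrier G" for y
    using that H.r_coset_hom_Mod by (auto simp: quot_map_def hom_def)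
  have "finprod (G Mod H) (quot_map G H) U \<noteq> \<one>\<^bsub>G Mod H\<^esub>" if "U \<subseteq> A" "U \<noteq> {}" for U
  proof -
    have "finprod (G Mod H) (quot_map G H) U = quot_map G H (finprod G (\<lambda>a. a) U)"
      using that assms(5,6) by (intro finprod_quot_map[OF assms(2)]) (auto intro: finite_subset)
    moreover have "finprod G (\<lambda>a. a) U \<in> nonempty_subset_sums G A"
      using that by (auto simp: nonempty_subset_sums_def)
    ultimately show ?thesis using neg by auto
  qed
  \<comment> \<open>The index set is A itself with the quotient map as values, so elements in one
    fibre remain distinct indices.\<close>
  then have free: "K.product_one_free (quot_map G H) A" by (simp add: K.product_one_free_def)
  have fibre: "fibre_card G H A k = card {a \<in> A. quot_map G H a = k}" for k
    unfolding fibre_card_def using assms(5) by (intro arg_cong[of _ _ card]) auto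
  define Q where "Q = (\<Sum>k\<in>carrier (G Mod H). (fibre_card G H A k)\<^sup>2)"
  have "(card A) ^ 3 \<le> 12288 * q * Q"
    unfolding Q_def fibre assms(4)
    using assms(5) qc by (intro K.card_cubed_le_sum_fibre_squares assms(3,6) free) auto
  then have "real ((card A) ^ 3) \<le> real (12288 * q * Q)" unfolding of_nat_le_iff .
  then have upper: "real (card A) ^ 3 \<le> 12288 * (real q * real Q)" by simp
  have "q > 0" unfolding assms(4) using assms(3) K.one_closed by (auto simp: card_gt_0_iff)
  moreover have "real Q < real (card A) ^ 3 / (10 ^ 5 * real q)" using assms(8) by (simp add: Q_def)
  \<comment> \<open>After clearing denominators the contradiction is 12288 against 10^5.\<close>
  ultimately have "100000 * (real q * real Q) < real (card A) ^ 3" by (simp add: field_simps)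
  moreover have "0 \<le> real q * real Q" by simp
  ultimately show False using upper by linarith
qed

end
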